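(* Let $m,n\ge 0$ be integers with $m\ge n-1$, and let $a,c$ be real numbers with $c\notin\{0,-1,-2,\ldots\}$. Consider the $[m/n]$ Padé approximant for ${}_2F_1(a,1;c;z)$. (i) If $a<c<1-m-n$, then all poles of this approximant lie in the interval $(0,1)$. (ii) If $c>a>n-m-1$, then all poles of this approximant lie in the interval $(1,\infty)$. (iii) If $a>n-m-1$ and $c<1-m-n$, then all poles of this approximant lie in the interval $(-\infty,0)$.
   Context: The Gauss hypergeometric series is ${}_2F_1(a,b;c;z)=\sum_{k\ge 0}\frac{(a)_k(b)_k}{(c)_k\,k!}z^k$, where $(\alpha)_0=1$ and $(\alpha)_k=\alpha(\alpha+1)\cdots(\alpha+k-1)$. The $[m/n]$ Padé approximant for a power series $f(z)=\sum_{k\ge0}t_kz^k$ is the (unique) rational function $P_{mn}(z)/Q_{mn}(z)$, with $P_{mn}$, $Q_{mn}$ polynomials, $\deg P_{mn}\le m$, $\deg Q_{mn}\le n$, $Q_{mn}\not\equiv 0$, such that $f(z)Q_{mn}(z)-P_{mn}(z)=O(z^{m+n+1})$ as $z\to0$. "Poles" means poles in the finite complex plane $\mathbb{C}$. *)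

theory Defs
  imports
    "HOL-Computational_Algebra.Computational_Algebra"
    "HOL-Complex_Analysis.Complex_Analysis"
begin

definition gauss_2F1 :: "'a::field_char_0 \<Rightarrow> 'a \<Rightarrow> 'a \<Rightarrow> 'a fps" where
  "gauss_2F1 a b c = fps_hypergeo [a, b] [c] 1"

lemma gauss_2F1_nth:
  "fps_nth (gauss_2F1 a b c) k =
     pochhammer a k * pochhammer b k / (pochhammer c k * fact k)"
  by (simp add: gauss_2F1_def fps_hypergeo_def)

text \<open>
  The polynomials \<open>P\<close> and \<open>Q\<close> represent the \<open>[m/n]\<close> approximant as the quotient \<open>P / Q\<close>.
  They may share factors, possibly powers of the variable, so only the quotient is
  determined; see \<open>is_pade_unique\<close>.
\<close>

definition is_pade ::
  "nat \<Rightarrow> nat \<Rightarrow> 'a::field fps \<Rightarrow> 'a poly \<Rightarrow> 'a poly \<Rightarrow> bool" where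
  "is_pade m n f P Q \<longleftrightarrow>
     degree P \<le> m \<and> degree Q \<le> n \<and> Q \<noteq> 0 \<and>
     fps_X ^ (m + n + 1) dvd f * fps_of_poly Q - fps_of_poly P"

lemma is_pade_unique:
  assumes "is_pade m n f P Q" and "is_pade m n f P' Q'"
  shows "P * Q' = P' * Q"
proof -
  let ?X = "fps_X ^ (m + n + 1) :: 'a fps"
  have "?X dvd (f * fps_of_poly Q' - fps_of_poly P') * fps_of_poly Q
             - (f * fps_of_poly Q - fps_of_poly P) * fps_of_poly Q'"
    using assms unfolding is_pade_def by (meson dvd_diff dvd_mult2)
  also have "\<dots> = fps_of_poly (P * Q' - P' * Q)"
    by (simp add: fps_of_poly_diff fps_of_poly_mult algebra_simps)
  finally obtain g where g: "fps_of_poly (P * Q' - P' * Q) = ?X * g"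
    by (elim dvdE)
  have deg: "degree (P * Q' - P' * Q) \<le> m + n"
    using assms unfolding is_pade_def
    by (intro degree_diff_le) (meson add_mono degree_mult_le order_trans)+
  have "coeff (P * Q' - P' * Q) k = 0" for k
  proof (cases "k \<le> m + n")
    case True
    have "coeff (P * Q' - P' * Q) k = fps_nth (?X * g) k"
      by (metis g fps_of_poly_nth)
    also have "\<dots> = 0"
      using True by (subst fps_X_power_mult_nth) auto
    finally show ?thesis .
  next
    case False
    with deg show ?thesis by (intro coeff_eq_0) auto
  qed
  hence "P * Q' - P' * Q = 0" by (intro poly_eqI) auto
  thus ?thesis by simp
qed

end

theory Submission imports Defs begin

text \<open>
  The denominator of the approximant is \<open>\<^sub>2F\<^sub>1(-n, -a-m; 1-c-m-n; z)\<close>. For \<open>c > 0\<close> and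
  \<open>b > c + n - 1\<close> the polynomial \<open>\<^sub>2F\<^sub>1(-n, b; c; x)\<close> is a Jacobi polynomial, and Rolle's theorem
  applied to a Rodrigues-type raising relation gives it \<open>n\<close> distinct zeros in \<open>(0, 1)\<close>. This is
  case (i). Reversing the coefficients (\<open>z \<mapsto> 1/z\<close>) turns case (ii) into it, and Pfaff's
  transformation (\<open>z \<mapsto> z/(z-1)\<close>) does the same for case (iii).
\<close>

section \<open>Rolle's theorem for finite sets of zeros\<close>

text \<open>Induction on the set by adding a new maximum \<open>b\<close>: the zeros of
  \<open>f'\<close> already found lie below \<open>Max A\<close>, and Rolle between
  \<open>Max A\<close> and \<open>b\<close> yields one more. Differentiability is asked only in the
  open interval because the weight treated next need not be differentiable at 0 and 1.\<close>

lemma Rolle_finite_set: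
  fixes f f' :: "real \<Rightarrow> real"
  assumes "finite S" and "S \<noteq> {}" and "\<And>x. x \<in> S \<Longrightarrow> f x = 0"
    and "continuous_on {Min S..Max S} f"
    and "\<And>x. Min S < x \<Longrightarrow> x < Max S \<Longrightarrow> (f has_real_derivative f' x) (at x)"
  shows "\<exists>T. finite T \<and> T \<subseteq> {Min S<..<Max S} \<and> card S = Suc (card T) \<and> (\<forall>x\<in>T. f' x = 0)"
  using assms
proof (induction S rule: finite_linorder_max_induct)
  case empty
  then show ?case by simp
next
  case (insert b A)
  show ?case
  proof (cases "A = {}")
    case True
    then show ?thesis by (intro exI[of _ "{}"]) auto
  next
    case False
    have MA: "Max A \<in> A" "Min A \<in> A" using False insert.hyps by auto
    have lt: "Max A < b" "Min A < b" using MA insert.hyps by auto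
    have Mm: "Max (insert b A) = b" "Min (insert b A) = Min A"
      using False insert.hyps lt by (simp_all add: Max_insert2 less_imp_le min_absorb2)
    have le: "Min A \<le> Max A" using False insert.hyps by auto
    have "\<exists>T. finite T \<and> T \<subseteq> {Min A<..<Max A} \<and> card A = Suc (card T) \<and> (\<forall>x\<in>T. f' x = 0)"
      using insert.prems False lt unfolding Mm
      by (intro insert.IH) (auto intro: continuous_on_subset)
    then obtain T where T: "finite T" "T \<subseteq> {Min A<..<Max A}" "card A = Suc (card T)"
        "\<forall>x\<in>T. f' x = 0" by blast
    have "\<exists>z. Max A < z \<and> z < b \<and> (*) (f' z) = (\<lambda>v. 0)"
    proof (rule Rolle_deriv)
      show "f (Max A) = f b" using insert.prems MA by simp
      show "continuous_on {Max A..b} f"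
        using insert.prems(3) le unfolding Mm by (auto intro: continuous_on_subset)
      show "(f has_derivative (*) (f' x)) (at x)" if "Max A < x" "x < b" for x
        using insert.prems(4)[of x] that le unfolding Mm has_field_derivative_def by simp
    qed (use lt in auto)
    then obtain z where z: "Max A < z" "z < b" "f' z = 0"
      by (metis mult.right_neutral)
    have "z \<notin> T" using T(2) z by auto
    then show ?thesis using T z insert.hyps le unfolding Mm
      by (intro exI[of _ "insert z T"]) (auto simp: card_insert_if)
  qed
qed

text \<open>
  Rolle for \<open>x\<^sup>u (1 - x)\<^sup>v p(x)\<close>, which also vanishes at both endpoints; its derivative is
  \<open>x\<^bsup>u-1\<^esup> (1 - x)\<^bsup>v-1\<^esup> q(x)\<close>.
\<close>

lemma Rolle_jacobi_weight:
  fixes p :: "real poly" and u v :: real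
  assumes "u > 0" "v > 0" "finite S" "S \<subseteq> {0<..<1}" "\<And>x. x \<in> S \<Longrightarrow> poly p x = 0"
  defines "q \<equiv> [:0, 1, -1:] * pderiv p + [:u, - (u + v):] * p"
  shows "\<exists>T. finite T \<and> T \<subseteq> {0<..<1} \<and> card T = Suc (card S) \<and> (\<forall>x\<in>T. poly q x = 0)"
proof -
  define f where "f = (\<lambda>x::real. x powr u * (1 - x) powr v * poly p x)"
  define f' where "f' = (\<lambda>x::real. x powr (u - 1) * (1 - x) powr (v - 1) * poly q x)"
  define A where "A = insert 0 (insert 1 S)"
  have A: "finite A" "A \<noteq> {}" "Min A = 0" "Max A = 1"
  proof -
    show "finite A" "A \<noteq> {}" using assms by (simp_all add: A_def)
    show "Min A = 0" using assms unfolding A_def by (intro Min_eqI) auto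
    show "Max A = 1" using assms unfolding A_def by (intro Max_eqI) auto
  qed
  have "\<exists>T. finite T \<and> T \<subseteq> {Min A<..<Max A} \<and> card A = Suc (card T) \<and> (\<forall>x\<in>T. f' x = 0)"
  proof (rule Rolle_finite_set)
    show "f x = 0" if "x \<in> A" for x
      using that assms unfolding A_def f_def by auto
    show "continuous_on {Min A..Max A} f"
      unfolding A f_def using assms
      by (intro continuous_intros continuous_on_powr') auto
    show "(f has_real_derivative f' x) (at x)" if "Min A < x" "x < Max A" for x
    proof -
      have x: "0 < x" "x < 1" using that A by auto
      have e: "x powr u = x powr (u - 1) * x" "(1 - x) powr v = (1 - x) powr (v - 1) * (1 - x)"
        using x by (simp_all add: powr_diff)
      have "(f has_real_derivative
          (u * x powr (u - 1) * (1 - x) powr v + x powr u * (- v * (1 - x) powr (v - 1))) * poly p x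
          + x powr u * (1 - x) powr v * poly (pderiv p) x) (at x)"
        unfolding f_def using x
        by (auto intro!: derivative_eq_intros simp: algebra_simps)
      also have "(u * x powr (u - 1) * (1 - x) powr v + x powr u * (- v * (1 - x) powr (v - 1))) * poly p x
          + x powr u * (1 - x) powr v * poly (pderiv p) x = f' x"
        unfolding f'_def e q_def by (simp add: algebra_simps)
      finally show ?thesis .
    qed
  qed (use A in auto)
  then obtain T where T: "finite T" "T \<subseteq> {0<..<1}" "card A = Suc (card T)" "\<forall>x\<in>T. f' x = 0"
    unfolding A by blast
  have "card A = Suc (Suc (card S))"
    using assms unfolding A_def by (subst card_insert_disjoint | force)+
  moreover have "poly q x = 0" if "x \<in> T" for x
    using T that unfolding f'_def by fastforce
  ultimately show ?thesis using T by auto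
qed

section \<open>Terminating hypergeometric polynomials and their zeros in (0, 1)\<close>

text \<open>This is \<open>\<^sub>2F\<^sub>1(-n, b; c; x)\<close>.\<close>

definition hyp_poly :: "nat \<Rightarrow> 'a::field_char_0 \<Rightarrow> 'a \<Rightarrow> 'a poly" where
  "hyp_poly n b c =
     (\<Sum>j\<le>n. monom (of_nat (n choose j) * (- 1) ^ j * pochhammer b j / pochhammer c j) j)"

lemma coeff_hyp_poly:
  "coeff (hyp_poly n b c) j = of_nat (n choose j) * (- 1) ^ j * pochhammer b j / pochhammer c j"
  by (cases "j \<le> n") (simp_all add: hyp_poly_def coeff_sum sum.delta binomial_eq_0)

lemma poly_hyp_poly:
  "poly (hyp_poly n b c) x =
     (\<Sum>j\<le>n. of_nat (n choose j) * (- 1) ^ j * pochhammer b j / pochhammer c j * x ^ j)"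
  by (simp add: hyp_poly_def poly_sum poly_monom)

lemma degree_hyp_poly: "degree (hyp_poly n b c) \<le> n"
  by (rule degree_le) (simp add: coeff_hyp_poly)

lemma poly_hyp_poly_0 [simp]: "poly (hyp_poly n b c) 0 = 1"
  by (simp add: poly_0_coeff_0 coeff_hyp_poly)

lemma hyp_poly_nonzero [simp]: "hyp_poly n b c \<noteq> 0"
  by (metis poly_0 poly_hyp_poly_0 zero_neq_one)

lemma poly_hyp_poly_of_real:
  "poly (hyp_poly n (of_real b) (of_real c)) (of_real x) = complex_of_real (poly (hyp_poly n b c) x)"
  by (simp add: poly_hyp_poly pochhammer_of_real)

text \<open>Coefficient form of the Rodrigues-type relation: with \<open>u = c - 1\<close> and
  \<open>v = b - n - c\<close>, the derivative of x^u (1 - x)^v 2F1(-n, b; c; x) is (c - 1) x^(u-1)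
  (1 - x)^(v-1) 2F1(-n-1, b-1; c-1; x). The right-hand side has the shape of \<open>q\<close> in
  \<open>Rolle_jacobi_weight\<close>.\<close>

lemma hyp_poly_raise:
  fixes b c :: "'a::field_char_0"
  assumes "c - 1 \<notin> \<int>\<^sub>\<le>\<^sub>0"
  shows "smult (c - 1) (hyp_poly (Suc n) (b - 1) (c - 1)) =
    [:0, 1, -1:] * pderiv (hyp_poly n b c) + [:c - 1, - (b - of_nat n - 1):] * hyp_poly n b c"
proof (rule poly_eqI)
  fix j
  have nz: "c - 1 \<noteq> 0" "\<And>i. pochhammer c i \<noteq> 0" "\<And>i. c + of_nat i \<noteq> 0"
  proof -
    have *: "c - 1 + of_nat i \<noteq> 0" for i
      using assms by (metis add_eq_0_iff2 minus_of_nat_in_nonpos_Ints)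
    show "c - 1 \<noteq> 0" using *[of 0] by simp
    show **: "c + of_nat i \<noteq> 0" for i using *[of "Suc i"] by (simp add: algebra_simps)
    show "pochhammer c i \<noteq> 0" for i
      using ** by (simp add: pochhammer_eq_0_iff eq_neg_iff_add_eq_0)
  qed
  show "coeff (smult (c - 1) (hyp_poly (Suc n) (b - 1) (c - 1))) j =
    coeff ([:0, 1, -1:] * pderiv (hyp_poly n b c) + [:c - 1, - (b - of_nat n - 1):] * hyp_poly n b c) j"
  proof (cases j)
    case 0
    then show ?thesis by (simp add: coeff_hyp_poly)
  next
    case (Suc i)
    \<comment> \<open>Once multiplied by \<open>c + i\<close> or \<open>c - 1\<close> where needed,
      all coefficients involved are multiples of \<open>r\<close>. What remains is a linear relation
      between (n choose i) and (n choose i+1), supplied by \<open>ab\<close>.\<close>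
    define r where "r = pochhammer b i / pochhammer c i * (-1) ^ i"
    have ab: "of_nat (Suc i) * of_nat (n choose Suc i) = (of_nat n - of_nat i) * (of_nat (n choose i) :: 'a)"
    proof (cases "i \<le> n")
      case True
      have "Suc i * (n choose Suc i) = (n - i) * (n choose i)"
        by (simp only: binomial_absorption binomial_absorb_comp)
      then have "of_nat (Suc i) * of_nat (n choose Suc i) = (of_nat (n - i) * of_nat (n choose i) :: 'a)"
        by (simp only: flip: of_nat_mult)
      then show ?thesis using True by (simp add: of_nat_diff)
    qed (simp add: binomial_eq_0)
    have f1: "coeff (hyp_poly n b c) i = of_nat (n choose i) * r"
      by (simp add: coeff_hyp_poly r_def)
    have f2: "coeff (hyp_poly n b c) (Suc i) * (c + of_nat i) = - of_nat (n choose Suc i) * (b + of_nat i) * r"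
      using nz by (simp add: coeff_hyp_poly r_def pochhammer_Suc)
    have l: "(c - 1) * coeff (hyp_poly (Suc n) (b - 1) (c - 1)) (Suc i) =
       - (of_nat (n choose Suc i) + of_nat (n choose i)) * (b - 1) * r"
    proof -
      have *: "(c - 1) * (x * (- 1) ^ Suc i * (b' * p) / ((c - 1) * q)) = - x * b' * (p / q * (- 1) ^ i)"
        for x b' p q :: 'a
        using nz(1) by simp
      show ?thesis
        unfolding coeff_hyp_poly pochhammer_rec r_def binomial_Suc_Suc of_nat_add diff_add_cancel
        by (simp only: * add.commute)
    qed
    have *: "coeff ([:0, 1, -1:] * pderiv p + [:u, - v:] * p) (Suc i) =
        (of_nat (Suc i) + u) * coeff p (Suc i) - (of_nat i + v) * coeff p i" for p and u v :: 'a
      by (cases i) (simp_all add: coeff_pderiv, simp_all add: algebra_simps)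
    have "coeff ([:0, 1, -1:] * pderiv (hyp_poly n b c) + [:c - 1, - (b - of_nat n - 1):] * hyp_poly n b c) (Suc i)
      = coeff (hyp_poly n b c) (Suc i) * (c + of_nat i) - (of_nat i + b - of_nat n - 1) * coeff (hyp_poly n b c) i"
      unfolding * by (simp add: algebra_simps)
    also have "\<dots> = (c - 1) * coeff (hyp_poly (Suc n) (b - 1) (c - 1)) (Suc i)"
    proof -
      have "- (of_nat (n choose Suc i) * (b + of_nat i)) - (of_nat i + b - of_nat n - 1) * of_nat (n choose i)
        = - (of_nat (n choose Suc i) + of_nat (n choose i)) * (b - 1)"
        using ab by (simp add: algebra_simps)
      from arg_cong[OF this, of "\<lambda>x. x * r"] show ?thesis
        unfolding f1 f2 l by (simp only: left_diff_distrib mult.assoc minus_mult_left)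
    qed
    finally show ?thesis using Suc by simp
  qed
qed

text \<open>The raising relation lowers \<open>b\<close> and \<open>c\<close> by 1, so the induction
  hypothesis is used at \<open>b + 1\<close> and \<open>c + 1\<close>. The weight then has exponents
  \<open>c\<close> and \<open>b - n - c\<close>, and the assumptions for \<open>Suc n\<close> say
  exactly that both are positive.\<close>

lemma hyp_poly_real_roots:
  fixes b c :: real
  assumes "c > 0" "b > c + real n - 1"
  shows "\<exists>S. finite S \<and> S \<subseteq> {0<..<1} \<and> card S = n \<and> (\<forall>x\<in>S. poly (hyp_poly n b c) x = 0)"
  using assms
proof (induction n arbitrary: b c)
  case 0
  then show ?case by (intro exI[of _ "{}"]) simp
next
  case (Suc n)
  let ?p = "hyp_poly n (b + 1) (c + 1)"
  obtain S where S: "finite S" "S \<subseteq> {0<..<1}" "card S = n" "\<forall>x\<in>S. poly ?p x = 0"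
    using Suc.IH[of "c + 1" "b + 1"] Suc.prems by auto
  have "c \<notin> \<int>\<^sub>\<le>\<^sub>0"
    using Suc.prems(1) nonpos_Ints_nonpos[of c] by linarith
  then have raise: "smult c (hyp_poly (Suc n) b c) =
      [:0, 1, -1:] * pderiv ?p + [:c, - (c + (b - real n - c)):] * ?p"
    using hyp_poly_raise[of "c + 1" n "b + 1"] by simp
  obtain T where T: "finite T" "T \<subseteq> {0<..<1}" "card T = Suc (card S)"
      "\<forall>x\<in>T. poly (smult c (hyp_poly (Suc n) b c)) x = 0"
    using Rolle_jacobi_weight[of c "b - real n - c" S ?p] S Suc.prems unfolding raise by auto
  then have "\<forall>x\<in>T. poly (hyp_poly (Suc n) b c) x = 0"
    using Suc.prems(1) by simp
  with T S(3) show ?case by blast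
qed

text \<open>The degree is at most n, so the n distinct real zeros already exhaust the complex
  ones.\<close>

lemma hyp_poly_roots_01:
  fixes b c :: real
  assumes "c > 0" "b > c + real n - 1"
    and z: "poly (hyp_poly n (of_real b) (of_real c)) z = (0 :: complex)"
  shows "z \<in> complex_of_real ` {0<..<1}"
proof -
  obtain S where S: "finite S" "S \<subseteq> {0<..<1}" "card S = n"
      "\<forall>x\<in>S. poly (hyp_poly n b c) x = 0"
    using hyp_poly_real_roots[OF assms(1,2)] by blast
  let ?p = "hyp_poly n (of_real b) (of_real c) :: complex poly"
  have "complex_of_real ` S = {z. poly ?p z = 0}"
  proof (rule card_seteq)
    show "finite {z. poly ?p z = 0}" by (rule poly_roots_finite) simp
    show "complex_of_real ` S \<subseteq> {z. poly ?p z = 0}"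
      using S(4) by (auto simp: poly_hyp_poly_of_real)
    have "card {z. poly ?p z = 0} \<le> degree ?p" by (rule card_poly_roots_bound) simp
    also have "\<dots> \<le> n" by (rule degree_hyp_poly)
    also have "n = card (complex_of_real ` S)"
      using S(3) by (simp add: card_image inj_on_def)
    finally show "card {z. poly ?p z = 0} \<le> card (complex_of_real ` S)" .
  qed
  with z have "z \<in> complex_of_real ` S" by simp
  with S(2) show ?thesis by blast
qed

section \<open>Pfaff's transformation and negative zeros\<close>

text \<open>The Chu-Vandermonde sum 2F1(-k, c-b; c; 1) = (b)_k / (c)_k, used to expand each
  coefficient in the proof of Pfaff's transformation.\<close>

lemma pochhammer_ratio_inversion:
  fixes b c :: "'a::field_char_0"
  assumes "c \<notin> \<int>\<^sub>\<le>\<^sub>0"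
  shows "pochhammer b k / pochhammer c k =
    (\<Sum>j\<le>k. (- 1) ^ j * of_nat (k choose j) * pochhammer (c - b) j / pochhammer c j)"
proof -
  have "\<forall>i\<in>{0..<k}. c \<noteq> - of_nat i" using assms by auto
  from Vandermonde_pochhammer[OF this, of "c - b"]
  have "pochhammer b k / pochhammer c k =
    (\<Sum>j\<le>k. pochhammer (c - b) j * pochhammer (- of_nat k) j / (fact j * pochhammer c j))"
    by (simp add: atLeast0AtMost)
  also have "\<dots> = (\<Sum>j\<le>k. (- 1) ^ j * of_nat (k choose j) * pochhammer (c - b) j / pochhammer c j)"
    by (intro sum.cong refl)
      (simp add: binomial_gbinomial gbinomial_pochhammer mult_ac flip: mult.assoc power_mult_distrib)
  finally show ?thesis .
qed

text \<open>Pfaff's identity 2F1(-n, b; c; z) = (1-z)^n 2F1(-n, c-b; c; z/(z-1)), with the power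
  multiplied into the sum so that it also makes sense at z = 1. Expand the coefficients by
  Chu-Vandermonde, exchange the sums and collapse the inner one.\<close>

lemma poly_hyp_poly_pfaff:
  fixes b c z :: "'a::field_char_0"
  assumes "c \<notin> \<int>\<^sub>\<le>\<^sub>0"
  shows "poly (hyp_poly n b c) z =
    (\<Sum>j\<le>n. of_nat (n choose j) * pochhammer (c - b) j / pochhammer c j * z ^ j * (1 - z) ^ (n - j))"
proof -
  let ?r = "\<lambda>j. pochhammer (c - b) j / pochhammer c j"
  \<comment> \<open>Since (n choose k)(k choose j) = (n choose j)(n-j choose k-j), this is z^j times
    the binomial expansion of (1-z)^(n-j).\<close>
  have inner: "(\<Sum>k\<le>n. of_nat (n choose k) * of_nat (k choose j) * (- 1) ^ (k + j) * z ^ k) =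
      of_nat (n choose j) * z ^ j * (1 - z) ^ (n - j)" if "j \<le> n" for j
  proof -
    have "(\<Sum>k\<le>n. of_nat (n choose k) * of_nat (k choose j) * (- 1) ^ (k + j) * z ^ k) =
        (\<Sum>k\<in>{j..n}. of_nat ((n choose k) * (k choose j)) * (- 1) ^ (k + j) * z ^ k)"
      by (rule sum.mono_neutral_cong_right) (auto simp: binomial_eq_0)
    also have "\<dots> = (\<Sum>i\<le>n - j. of_nat ((n choose j) * (n - j choose i)) * (- z) ^ i * z ^ j)"
    proof (rule sum.reindex_bij_witness[of _ "\<lambda>i. i + j" "\<lambda>k. k - j"])
      fix k assume k: "k \<in> {j..n}"
      then obtain i where i: "k = j + i" using le_Suc_ex by auto
      have "(n choose k) * (k choose j) = (n choose j) * (n - j choose (k - j))"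
        using choose_mult[of j k n] k by auto
      moreover have "(- z) ^ i = (- 1) ^ (j + i + j) * z ^ i"
      proof -
        have "(- 1 :: 'a) ^ (j + i + j) = (- 1) ^ (i + 2 * j)" by (simp add: mult_2 add_ac)
        also have "\<dots> = (- 1) ^ i" by (simp add: power_add)
        finally show ?thesis by (simp add: power_minus[of z i])
      qed
      ultimately show "of_nat ((n choose j) * (n - j choose (k - j))) * (- z) ^ (k - j) * z ^ j =
          of_nat ((n choose k) * (k choose j)) * (- 1) ^ (k + j) * z ^ k"
        by (simp only: i diff_add_inverse) (simp add: power_add)
    qed (use that in auto)
    also have "\<dots> = of_nat (n choose j) * z ^ j *
        (\<Sum>i\<le>n - j. of_nat (n - j choose i) * (- z) ^ i * 1 ^ (n - j - i))"
      by (simp add: sum_distrib_left mult_ac)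
    also have "\<dots> = of_nat (n choose j) * z ^ j * (1 - z) ^ (n - j)"
      by (subst binomial_ring[symmetric]) simp
    finally show ?thesis .
  qed
  have "poly (hyp_poly n b c) z =
      (\<Sum>k\<le>n. of_nat (n choose k) * (- 1) ^ k * z ^ k * (pochhammer b k / pochhammer c k))"
    by (simp add: poly_hyp_poly mult_ac)
  also have "\<dots> = (\<Sum>k\<le>n. \<Sum>j\<le>k. of_nat (n choose k) * of_nat (k choose j) * (- 1) ^ (k + j) * z ^ k * ?r j)"
    by (intro sum.cong refl, subst pochhammer_ratio_inversion[OF assms])
      (simp add: sum_distrib_left power_add mult_ac)
  \<comment> \<open>The added terms vanish because k choose j = 0 for j > k; over the full square
    the sums can be exchanged.\<close>
  also have "\<dots> = (\<Sum>k\<le>n. \<Sum>j\<le>n. of_nat (n choose k) * of_nat (k choose j) * (- 1) ^ (k + j) * z ^ k * ?r j)"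
    by (intro sum.cong refl sum.mono_neutral_left) (auto simp: binomial_eq_0)
  also have "\<dots> = (\<Sum>j\<le>n. (\<Sum>k\<le>n. of_nat (n choose k) * of_nat (k choose j) * (- 1) ^ (k + j) * z ^ k) * ?r j)"
    by (subst sum.swap) (simp only: sum_distrib_right)
  also have "\<dots> = (\<Sum>j\<le>n. of_nat (n choose j) * z ^ j * (1 - z) ^ (n - j) * ?r j)"
    by (intro sum.cong refl) (simp add: inner)
  finally show ?thesis by (simp add: mult_ac)
qed

lemma complex_of_real_in_nonpos_IntsD:
  assumes "complex_of_real c \<in> \<int>\<^sub>\<le>\<^sub>0"
  shows "c \<in> \<int>\<^sub>\<le>\<^sub>0"
proof -
  obtain k where "complex_of_real c = - of_nat k"
    using assms by (rule nonpos_Ints_cases')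
  then have "complex_of_real c = of_real (- real k)" by simp
  then have "c = - real k" by (simp only: of_real_eq_iff)
  then show ?thesis by simp
qed

text \<open>The condition b < 1 - n says that c - b > c + n - 1, so after Pfaff's transformation the
  zeros z/(z-1) lie in (0, 1), which forces z < 0.\<close>

lemma hyp_poly_roots_neg:
  fixes b c :: real
  assumes "c > 0" "b < 1 - real n"
    and z: "poly (hyp_poly n (of_real b) (of_real c)) z = (0 :: complex)"
  shows "z \<in> complex_of_real ` {..<0}"
proof -
  let ?t = "\<lambda>j. pochhammer (complex_of_real (c - b)) j / pochhammer (complex_of_real c) j"
  have c: "complex_of_real c \<notin> \<int>\<^sub>\<le>\<^sub>0"
    using assms(1) nonpos_Ints_nonpos[of c] complex_of_real_in_nonpos_IntsD[of c] by auto
  have sum0: "(\<Sum>j\<le>n. of_nat (n choose j) * ?t j * z ^ j * (1 - z) ^ (n - j)) = 0"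
    using z poly_hyp_poly_pfaff[OF c, of n "of_real b" z] by simp
  \<comment> \<open>At z = 1 only the term j = n survives, and it equals the positive number (c-b)_n
    / (c)_n.\<close>
  have "z \<noteq> 1"
  proof
    assume z1: "z = 1"
    have "(\<Sum>j\<le>n. of_nat (n choose j) * ?t j * z ^ j * (1 - z) ^ (n - j)) =
        (\<Sum>j\<in>{n}. of_nat (n choose j) * ?t j * z ^ j * (1 - z) ^ (n - j))"
      by (rule sum.mono_neutral_right) (auto simp: z1)
    then have "?t n = 0" using sum0 z1 by simp
    moreover have "pochhammer (c - b) n > 0" "pochhammer c n > 0"
      using assms(1,2) by (cases "n = 0"; simp add: pochhammer_pos)+
    ultimately show False by (simp only: pochhammer_of_real) auto
  qed
  have "(\<Sum>j\<le>n. of_nat (n choose j) * ?t j * z ^ j * (1 - z) ^ (n - j)) =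
      (1 - z) ^ n * poly (hyp_poly n (of_real (c - b)) (of_real c)) (z / (z - 1))"
    unfolding poly_hyp_poly sum_distrib_left
  proof (intro sum.cong refl)
    fix j assume "j \<in> {..n}"
    then have pw: "(1 - z) ^ n = (1 - z) ^ (n - j) * (1 - z) ^ j"
      by (simp flip: power_add)
    have zj: "(1 - z) ^ j * ((- 1) ^ j * (z / (z - 1)) ^ j) = z ^ j"
    proof -
      have "(1 - z) * (- 1 * (z / (z - 1))) = z" using \<open>z \<noteq> 1\<close> by (simp add: field_simps)
      then show ?thesis by (simp only: flip: power_mult_distrib)
    qed
    show "of_nat (n choose j) * ?t j * z ^ j * (1 - z) ^ (n - j) = (1 - z) ^ n *
       (of_nat (n choose j) * (- 1) ^ j * pochhammer (of_real (c - b)) j /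
        pochhammer (of_real c) j * (z / (z - 1)) ^ j)"
      unfolding pw zj[symmetric]
      by (simp only: mult_ac times_divide_eq_left times_divide_eq_right)
  qed
  with sum0 \<open>z \<noteq> 1\<close> have "poly (hyp_poly n (of_real (c - b)) (of_real c)) (z / (z - 1)) = 0"
    by simp
  then have "z / (z - 1) \<in> complex_of_real ` {0<..<1}"
    using assms(1,2) by (intro hyp_poly_roots_01[where b = "c - b" and c = c]) auto
  then obtain t where t: "z / (z - 1) = of_real t" "0 < t" "t < 1" by auto
  then have "z = of_real t * (z - 1)" using \<open>z \<noteq> 1\<close> by (simp add: field_simps)
  then have "z * (of_real t - 1) = of_real t" by (simp add: algebra_simps)
  then have "z = of_real (t / (t - 1))" using t by (simp add: field_simps)
  moreover have "t / (t - 1) < 0" using t by (simp add: divide_pos_neg)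
  ultimately show ?thesis by blast
qed

section \<open>Reversal of coefficients and zeros beyond 1\<close>

text \<open>Up to sign, the factors of the first symbol are c + n - 1, ..., c + j, the last n - j
  factors of \<open>pochhammer c n\<close>.\<close>

lemma pochhammer_reflect:
  fixes c :: "'a::comm_ring_1"
  assumes "j \<le> n"
  shows "pochhammer (1 - of_nat n - c) (n - j) * pochhammer c j = (- 1) ^ (n - j) * pochhammer c n"
proof -
  have "pochhammer (1 - of_nat n - c) (n - j) = pochhammer (- (c + of_nat n - 1)) (n - j)"
    by (simp add: algebra_simps)
  also have "\<dots> = (- 1) ^ (n - j) * pochhammer (c + of_nat j) (n - j)"
    using assms by (subst pochhammer_minus) (simp add: of_nat_diff algebra_simps)
  finally show ?thesis
    using pochhammer_product[OF assms, of c] by (simp add: mult_ac)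
qed

text \<open>Substitute j by n - j in the sum; reflecting the Pochhammer symbols makes
  \<open>b\<close> and \<open>c\<close> trade places.\<close>

lemma poly_hyp_poly_reverse:
  fixes b c z :: "'a::field_char_0"
  assumes "z \<noteq> 0" "pochhammer b n \<noteq> 0" "pochhammer c n \<noteq> 0"
  shows "poly (hyp_poly n b c) z = (- 1) ^ n * pochhammer b n / pochhammer c n * z ^ n *
    poly (hyp_poly n (1 - of_nat n - c) (1 - of_nat n - b)) (1 / z)"
  unfolding poly_hyp_poly sum_distrib_left
proof (rule sum.reindex_bij_witness[of _ "\<lambda>j. n - j" "\<lambda>j. n - j"])
  fix j assume "j \<in> {..n}"
  then have j: "j \<le> n" by simp
  have nz: "pochhammer b j \<noteq> 0" "pochhammer c j \<noteq> 0"
    using assms pochhammer_neq_0_mono j by blast+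
  have eq: "pochhammer (1 - of_nat n - c) (n - j) = (- 1) ^ (n - j) * pochhammer c n / pochhammer c j"
     "pochhammer (1 - of_nat n - b) (n - j) = (- 1) ^ (n - j) * pochhammer b n / pochhammer b j"
    using pochhammer_reflect[OF j, of b] pochhammer_reflect[OF j, of c] nz
    by (simp_all add: field_simps)
  have s: "(- 1) ^ n * (- 1) ^ (n - j) = ((- 1) ^ j :: 'a)"
  proof -
    have "(- 1) ^ n * (- 1) ^ (n - j) = ((- 1) ^ j * ((- 1) ^ (n - j) * (- 1) ^ (n - j)) :: 'a)"
      using j by (simp only: flip: mult.assoc power_add) simp
    then show ?thesis by (simp flip: power_mult_distrib)
  qed
  have z: "z ^ n * (1 / z) ^ (n - j) = z ^ j"
    using assms(1) j by (simp add: power_diff power_divide)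
  have "(- 1) ^ n * pochhammer b n / pochhammer c n * z ^ n *
       (of_nat (n choose (n - j)) * (- 1) ^ (n - j) * pochhammer (1 - of_nat n - c) (n - j) /
        pochhammer (1 - of_nat n - b) (n - j) * (1 / z) ^ (n - j)) =
     of_nat (n choose j) * ((- 1) ^ n * (- 1) ^ (n - j)) * (pochhammer b n / pochhammer c n *
       (pochhammer (1 - of_nat n - c) (n - j) / pochhammer (1 - of_nat n - b) (n - j))) *
       (z ^ n * (1 / z) ^ (n - j))"
    using j by (simp add: binomial_symmetric[OF j])
  also have "pochhammer b n / pochhammer c n *
       (pochhammer (1 - of_nat n - c) (n - j) / pochhammer (1 - of_nat n - b) (n - j)) =
       pochhammer b j / pochhammer c j"
    unfolding eq using nz assms by simp
  finally show "(- 1) ^ n * pochhammer b n / pochhammer c n * z ^ n *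
       (of_nat (n choose (n - j)) * (- 1) ^ (n - j) * pochhammer (1 - of_nat n - c) (n - j) /
        pochhammer (1 - of_nat n - b) (n - j) * (1 / z) ^ (n - j)) =
       of_nat (n choose j) * (- 1) ^ j * pochhammer b j / pochhammer c j * z ^ j"
    unfolding s z by simp
qed auto

text \<open>For the reversed parameters 1-n-c and 1-n-b, the first two assumptions are exactly the
  hypotheses of \<open>hyp_poly_roots_01\<close>, so 1/z lies in (0, 1).\<close>

lemma hyp_poly_roots_gt_1:
  fixes b c :: real
  assumes "b < 1 - real n" "b > c + real n - 1" "pochhammer c n \<noteq> 0"
    and z: "poly (hyp_poly n (of_real b) (of_real c)) z = (0 :: complex)"
  shows "z \<in> complex_of_real ` {1<..}"
proof -
  have z0: "z \<noteq> 0" using z by auto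
  have "pochhammer b n \<noteq> 0"
    using assms(1) by (auto simp: pochhammer_eq_0_iff)
  then have nz: "pochhammer (complex_of_real b) n \<noteq> 0" "pochhammer (complex_of_real c) n \<noteq> 0"
    using assms(3) by (simp_all add: pochhammer_of_real)
  have "poly (hyp_poly n (of_real (1 - real n - c)) (of_real (1 - real n - b))) (1 / z) = 0"
    using poly_hyp_poly_reverse[OF z0 nz] z nz z0 by simp
  then have "1 / z \<in> complex_of_real ` {0<..<1}"
    using assms(1,2)
    by (intro hyp_poly_roots_01[where b = "1 - real n - c" and c = "1 - real n - b"]) auto
  then obtain t where t: "1 / z = of_real t" "0 < t" "t < 1" by auto
  then have "z = of_real (1 / t)" using z0 by (simp add: field_simps)
  moreover have "1 / t > 1" using t by simp
  ultimately show ?thesis by blast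
qed

section \<open>The denominator of the approximant\<close>

text \<open>Up to sign this is an n-th finite difference. Pascal's rule turns the sum for
  \<open>Suc n\<close> and \<open>p\<close> into the sum for \<open>n\<close> and p(x) - p(x+1),
  whose degree is smaller unless it is zero.\<close>

lemma alternating_binomial_sum_poly:
  fixes p :: "'a::{idom,ring_char_0} poly"
  assumes "degree p < n"
  shows "(\<Sum>j\<le>n. (- 1) ^ j * of_nat (n choose j) * poly p (of_nat j)) = 0"
  using assms
proof (induction n arbitrary: p)
  case (Suc n)
  define q where "q = p - pcompose p [:1, 1:]"
  have q: "poly q x = poly p x - poly p (x + 1)" for x
    by (simp add: q_def poly_pcompose add.commute)
  have "(\<Sum>j\<le>Suc n. (- 1) ^ j * of_nat (Suc n choose j) * poly p (of_nat j)) =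
      poly p 0 - (\<Sum>j\<le>n. (- 1) ^ j * of_nat (Suc n choose Suc j) * poly p (of_nat (Suc j)))"
    by (subst sum.atMost_Suc_shift) (simp add: sum_negf)
  also have "\<dots> = poly p 0 - (\<Sum>j\<le>n. (- 1) ^ j * of_nat (n choose Suc j) * poly p (of_nat (Suc j)))
      - (\<Sum>j\<le>n. (- 1) ^ j * of_nat (n choose j) * poly p (of_nat (Suc j)))"
    by (simp add: ring_distribs sum.distrib)
  also have "poly p 0 - (\<Sum>j\<le>n. (- 1) ^ j * of_nat (n choose Suc j) * poly p (of_nat (Suc j))) =
      (\<Sum>j\<le>Suc n. (- 1) ^ j * of_nat (n choose j) * poly p (of_nat j))"
    by (subst sum.atMost_Suc_shift) (simp add: sum_negf)
  also have "\<dots> = (\<Sum>j\<le>n. (- 1) ^ j * of_nat (n choose j) * poly p (of_nat j))"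
    by (simp add: binomial_eq_0)
  also have "\<dots> - (\<Sum>j\<le>n. (- 1) ^ j * of_nat (n choose j) * poly p (of_nat (Suc j))) =
      (\<Sum>j\<le>n. (- 1) ^ j * of_nat (n choose j) * poly q (of_nat j))"
    by (simp add: q algebra_simps flip: sum_subtractf)
  also have "\<dots> = 0"
  proof (cases "q = 0")
    \<comment> \<open>A shift preserves degree and leading coefficient, so the top terms cancel in
      \<open>q\<close>.\<close>
    case False
    have d: "degree (pcompose p [:1, 1:]) = degree p"
      by (simp add: degree_pcompose)
    moreover have "coeff q (degree p) = 0"
      using lead_coeff_comp[of "[:1, 1:]" p] by (simp add: q_def d)
    moreover have "degree q \<le> degree p"
      unfolding q_def by (rule degree_diff_le) (simp_all add: d)
    ultimately have "degree q < degree p"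
      using False by (metis le_neq_implies_less leading_coeff_0_iff)
    then show ?thesis using Suc by simp
  qed simp
  finally show ?case .
qed simp

lemma fps_X_power_dvdI:
  fixes f :: "'a::field fps"
  assumes "\<And>k. k < n \<Longrightarrow> fps_nth f k = 0"
  shows "fps_X ^ n dvd f"
proof (cases "f = 0")
  case False
  then show ?thesis
    using assms by (subst fps_dvd_iff) (auto simp: fps_X_power_subdegree intro: subdegree_geI)
qed simp

text \<open>Truncation makes the coefficients up to z^m agree, so only the n coefficients of
  z^(m+1), ..., z^(m+n) must be shown to vanish.\<close>

lemma is_pade_hyp_poly:
  fixes a c :: "'a::field_char_0"
  assumes mn: "n \<le> m + 1" and c: "c \<notin> \<int>\<^sub>\<le>\<^sub>0"
  defines "Q \<equiv> hyp_poly n (- a - of_nat m) (1 - c - of_nat m - of_nat n)"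
  shows "is_pade m n (gauss_2F1 a 1 c)
    (truncate_fps (m + 1) (gauss_2F1 a 1 c * fps_of_poly Q)) Q"
proof -
  let ?f = "gauss_2F1 a 1 c"
  have nz: "pochhammer c i \<noteq> 0" for i
    using c by (auto simp: pochhammer_eq_0_iff)
  have main: "fps_nth (?f * fps_of_poly Q) (m + 1 + i) = 0" if "i < n" for i
  proof -
    define k where "k = m + 1 + i"
    define p where "p = (\<Prod>l<i. [:a + of_nat (m + 1 + l), -1:]) *
        (\<Prod>l<n - 1 - i. [:c + of_nat (k + l), -1:])"
    have poly_p: "poly p (of_nat j) = pochhammer (a + of_nat (m + 1 - j)) i *
        pochhammer (c + of_nat (k - j)) (n - 1 - i)" if "j \<le> m + 1" for j
      using that by (simp add: p_def poly_prod pochhammer_prod k_def of_nat_diff atLeast0LessThan algebra_simps)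
    \<comment> \<open>Up to a factor independent of \<open>j\<close>, the summands of the coefficient of \<open>z\<^sup>k\<close> are
      \<open>(-1)\<^sup>j (n choose j) p(j)\<close> with \<open>deg p < n\<close>, so the coefficient is an \<open>n\<close>-th difference.\<close>
    have "degree p \<le> i + (n - 1 - i)"
      unfolding p_def
      by (rule order.trans[OF degree_mult_le] add_mono order.trans[OF degree_prod_sum_le] | simp)+
    then have deg: "degree p < n" using that by simp
    have summand: "coeff Q j * fps_nth ?f (k - j) =
        pochhammer a (m + 1) / pochhammer c (m + n) * ((- 1) ^ j * of_nat (n choose j) * poly p (of_nat j))"
      if j: "j \<le> n" for j
    proof -
      \<comment> \<open>Here n <= m + 1 enters: it makes \<open>m + 1 - j\<close> a true difference
        for every j <= n.\<close>
      have jm: "j \<le> m + 1" using j mn by simp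
      have e1: "pochhammer (- a - of_nat m) j = (- 1) ^ j * pochhammer (a + of_nat (m + 1 - j)) j"
        using pochhammer_minus[of "a + of_nat m" j] jm by (simp add: of_nat_diff algebra_simps)
      have e2: "pochhammer (1 - c - of_nat m - of_nat n) j = (- 1) ^ j * pochhammer (c + of_nat (m + n - j)) j"
        using pochhammer_minus[of "c + of_nat m + of_nat n - 1" j] j by (simp add: of_nat_diff algebra_simps)
      have kj: "k - j = (m + 1 - j) + i" "m + n - j = (k - j) + (n - 1 - i)"
        using jm j \<open>i < n\<close> by (auto simp: k_def)
      \<comment> \<open>Splitting both symbols at \<open>m + 1 - j\<close> extracts
        \<open>pochhammer a (m + 1)\<close>, which is free of j; the rest is the first factor of
        p(j).\<close>
      have e3: "pochhammer a (k - j) * pochhammer (a + of_nat (m + 1 - j)) j =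
          pochhammer a (m + 1) * pochhammer (a + of_nat (m + 1 - j)) i"
        unfolding kj(1) using pochhammer_product'[of a "m + 1 - j" i] pochhammer_product'[of a "m + 1 - j" j] jm
        by simp
      \<comment> \<open>Cut (c)_(m+n) at k - j and at m + n - j: the outer blocks form the
        denominator of the summand, and the middle block is the second factor of p(j).\<close>
      have "pochhammer c (m + n) = pochhammer c (m + n - j) * pochhammer (c + of_nat (m + n - j)) j"
        using pochhammer_product'[of c "m + n - j" j] j by simp
      also have "pochhammer c (m + n - j) = pochhammer c (k - j) * pochhammer (c + of_nat (k - j)) (n - 1 - i)"
        unfolding kj(2) by (rule pochhammer_product')
      finally have e4: "pochhammer c (m + n) = pochhammer c (k - j) *
          pochhammer (c + of_nat (k - j)) (n - 1 - i) * pochhammer (c + of_nat (m + n - j)) j" .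
      have nz': "pochhammer (c + of_nat (k - j)) (n - 1 - i) \<noteq> 0" "pochhammer (c + of_nat (m + n - j)) j \<noteq> 0"
        using nz[of "m + n"] unfolding e4 by auto
      \<comment> \<open>The parameter 1 makes (1)_(k-j) cancel the factorial, and the signs from
        \<open>e1\<close> and \<open>e2\<close> cancel each other.\<close>
      have "coeff Q j * fps_nth ?f (k - j) = (- 1) ^ j * of_nat (n choose j) *
          (pochhammer a (k - j) * pochhammer (a + of_nat (m + 1 - j)) j) /
          (pochhammer c (k - j) * pochhammer (c + of_nat (m + n - j)) j)"
        by (simp add: Q_def coeff_hyp_poly e1 e2 gauss_2F1_nth flip: pochhammer_fact)
          (simp add: mult_ac)
      also have "\<dots> = pochhammer a (m + 1) / pochhammer c (m + n) *
          ((- 1) ^ j * of_nat (n choose j) * poly p (of_nat j))"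
        unfolding e3 e4 poly_p[OF jm] using nz' nz by simp
      finally show ?thesis .
    qed
    have "fps_nth (?f * fps_of_poly Q) k = (\<Sum>j=0..k. coeff Q j * fps_nth ?f (k - j))"
      by (subst mult.commute) (simp add: fps_mult_nth)
    also have "\<dots> = (\<Sum>j\<le>n. coeff Q j * fps_nth ?f (k - j))"
      using mn by (intro sum.mono_neutral_right) (auto simp: k_def Q_def coeff_hyp_poly binomial_eq_0)
    also have "\<dots> = pochhammer a (m + 1) / pochhammer c (m + n) *
        (\<Sum>j\<le>n. (- 1) ^ j * of_nat (n choose j) * poly p (of_nat j))"
      unfolding sum_distrib_left by (intro sum.cong refl summand) simp
    also have "\<dots> = 0"
      by (simp only: alternating_binomial_sum_poly[OF deg] mult_zero_right)
    finally show ?thesis unfolding k_def .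
  qed
  have "fps_X ^ (m + n + 1) dvd ?f * fps_of_poly Q - fps_of_poly (truncate_fps (m + 1) (?f * fps_of_poly Q))"
  proof (rule fps_X_power_dvdI)
    fix k assume k: "k < m + n + 1"
    show "fps_nth (?f * fps_of_poly Q - fps_of_poly (truncate_fps (m + 1) (?f * fps_of_poly Q))) k = 0"
    proof (cases "k < m + 1")
      case False
      then have "k = m + 1 + (k - m - 1)" "k - m - 1 < n" using k by auto
      then have "fps_nth (?f * fps_of_poly Q) k = 0" using main by metis
      then show ?thesis using False by simp
    qed simp
  qed
  moreover have "degree (truncate_fps (m + 1) (?f * fps_of_poly Q)) \<le> m"
    using degree_truncate_fps[of "m + 1"] by (simp add: less_Suc_eq_le)
  ultimately show ?thesis
    unfolding is_pade_def by (simp add: Q_def degree_hyp_poly)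
qed

section \<open>From poles to zeros of the explicit denominator\<close>

text \<open>Off the finitely many zeros of \<open>Q * Q'\<close> the two quotients agree. Where
  \<open>Q'\<close> does not vanish, the second has a finite limit, so the first cannot have a pole
  there, whatever common factors \<open>P\<close> and \<open>Q\<close> have.\<close>

lemma is_pole_poly_quotient_imp_root:
  fixes P Q P' Q' :: "complex poly"
  assumes eq: "P * Q' = P' * Q" and nz: "Q \<noteq> 0" 
    and pole: "is_pole (\<lambda>w. poly P w / poly Q w) z"
  shows "poly Q' z = 0"
proof (rule ccontr)
  assume nr: "poly Q' z \<noteq> 0"
  then have "Q' \<noteq> 0" by auto
  then have "finite {w. poly (Q * Q') w = 0}"
    using nz by (intro poly_roots_finite) simp
  then have "eventually (\<lambda>w. w \<notin> {w. poly (Q * Q') w = 0}) (at z)"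
    using islimpt_finite islimpt_iff_eventually by blast
  then have "eventually (\<lambda>w. poly P w / poly Q w = poly P' w / poly Q' w) (at z)"
  proof eventually_elim
    case (elim w)
    have "poly P w * poly Q' w = poly P' w * poly Q w"
      using arg_cong[OF eq, of "\<lambda>p. poly p w"] by simp
    with elim show ?case by (simp add: frac_eq_eq)
  qed
  then have "is_pole (\<lambda>w. poly P' w / poly Q' w) z"
    using pole by (subst (asm) is_pole_cong[OF _ refl])
  moreover have "((\<lambda>w. poly P' w / poly Q' w) \<longlongrightarrow> poly P' z / poly Q' z) (at z)"
    using nr by (intro tendsto_intros)
  ultimately show False
    unfolding is_pole_def using not_tendsto_and_filterlim_at_infinity[of "at z"] by auto
qed

theorem corollary5:
  fixes m n :: nat and a c :: real and P Q :: "complex poly"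
  assumes mn: "int m \<ge> int n - 1"
    and c: "c \<notin> \<int>\<^sub>\<le>\<^sub>0"
    and pade: "is_pade m n (gauss_2F1 (of_real a) 1 (of_real c)) P Q"
  shows
    "(a < c \<and> c < 1 - real m - real n \<longrightarrow>
        {z. is_pole (\<lambda>w. poly P w / poly Q w) z} \<subseteq> complex_of_real ` {0<..<1}) \<and>
     (c > a \<and> a > real n - real m - 1 \<longrightarrow>
        {z. is_pole (\<lambda>w. poly P w / poly Q w) z} \<subseteq> complex_of_real ` {1<..}) \<and>
     (a > real n - real m - 1 \<and> c < 1 - real m - real n \<longrightarrow>
        {z. is_pole (\<lambda>w. poly P w / poly Q w) z} \<subseteq> complex_of_real ` {..<0})"
proof -
  \<comment> \<open>In these parameters a < c becomes b' > c' + n - 1, c < 1 - m - n becomes c' > 0,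
    and a > n - m - 1 becomes b' < 1 - n. Each case of the theorem thus matches one of the three
    lemmas on zeros.\<close>
  define b' c' where "b' = - a - real m" and "c' = 1 - c - real m - real n"
  have root: "poly (hyp_poly n (of_real b') (of_real c')) z = 0"
    if "is_pole (\<lambda>w. poly P w / poly Q w) z" for z
  proof -
    have "complex_of_real c \<notin> \<int>\<^sub>\<le>\<^sub>0" "n \<le> m + 1"
      using c mn complex_of_real_in_nonpos_IntsD by auto
    note pade' = is_pade_hyp_poly[OF this(2,1), of "of_real a"]
    have "- complex_of_real a - of_nat m = of_real b'"
      "1 - complex_of_real c - of_nat m - of_nat n = of_real c'"
      by (simp_all add: b'_def c'_def)
    with pade' obtain P' :: "complex poly" where "is_pade m n (gauss_2F1 (of_real a) 1 (of_real c)) P'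
        (hyp_poly n (of_real b') (of_real c'))"
      by metis
    then have "P * hyp_poly n (of_real b') (of_real c') = P' * Q"
      using is_pade_unique pade by blast
    moreover have "Q \<noteq> 0" using pade by (simp add: is_pade_def)
    ultimately show ?thesis using is_pole_poly_quotient_imp_root that by blast
  qed
  \<comment> \<open>Needed for (ii), where \<open>c'\<close> may be negative: a vanishing factor
    would make \<open>c\<close> a nonpositive integer.\<close>
  have c'_nz: "pochhammer c' n \<noteq> 0"
  proof
    assume "pochhammer c' n = 0"
    then obtain k where k: "k < n" "c' = - real k" by (auto simp: pochhammer_eq_0_iff)
    then have "c = - real (m + n - 1 - k)" by (simp add: c'_def of_nat_diff)
    then have "c \<in> \<int>\<^sub>\<le>\<^sub>0" by (simp only: minus_of_nat_in_nonpos_Ints)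
    with c show False ..
  qed
  have "z \<in> complex_of_real ` {0<..<1}"
    if "a < c" "c < 1 - real m - real n" "is_pole (\<lambda>w. poly P w / poly Q w) z" for z
    by (rule hyp_poly_roots_01[OF _ _ root[OF that(3)]]) (use that in \<open>auto simp: b'_def c'_def\<close>)
  moreover have "z \<in> complex_of_real ` {1<..}"
    if "c > a" "a > real n - real m - 1" "is_pole (\<lambda>w. poly P w / poly Q w) z" for z
    by (rule hyp_poly_roots_gt_1[OF _ _ c'_nz root[OF that(3)]]) (use that in \<open>auto simp: b'_def c'_def\<close>)
  moreover have "z \<in> complex_of_real ` {..<0}"
    if "a > real n - real m - 1" "c < 1 - real m - real n" "is_pole (\<lambda>w. poly P w / poly Q w) z" for z
    by (rule hyp_poly_roots_neg[OF _ _ root[OF that(3)]]) (use that in \<open>auto simp: b'_def c'_def\<close>)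
  ultimately show ?thesis by blast
qed

end
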